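(* Let $L$ be a lattice with transfer multiplicity one, and suppose that in both directions the transfer matrices are the same real symmetric matrix, i.e. for every $m\ge 1$ the transfer matrix for gluing columns with $m+1$ entries and the transfer matrix for gluing rows with $m+1$ entries are equal (same index set of $0/1$-vectors, same entries) and symmetric. Then the entropy constants of $L$ on the plane, on the cylinder and on the torus are the same: the limits $$\lim_{m,n\to\infty} i(G_{m,n})^{1/|V(G_{m,n})|},\qquad \lim_{m,n\to\infty} i(H_{n,m})^{1/|V(H_{n,m})|},\qquad \lim_{m,n\to\infty} i(S_{n,m})^{1/|V(S_{n,m})|}$$ exist and are equal, where $i(\cdot)$ denotes the number of independent sets.
   Context: A lattice $L$ is given as a graph with vertex set $\{(i,j): i,j\in\mathbb Z_{\ge 0}\}$ ($i$ = row, $j$ = column). For positive integers $m,n$, the plane lattice graph $G_{m,n}$ is the subgraph of $L$ induced on $\{0,\dots,m\}\times\{0,\dots,n\}$, so its vertices are arranged in $m+1$ rows and $n+1$ columns. An independent set (the empty set included) is recorded column by column by $0/1$-vectors of length $m+1$, or row by row by $0/1$-vectors of length $n+1$. Transfer matrix for gluing columns: assume every edge of $L$ joins vertices in the same column or in consecutive columns. For a step $j\to j+1$, the transfer matrix has rows (resp. columns) indexed by the vectors in $\{0,1\}^{m+1}$ representing independent sets inside column $j$ (resp. column $j+1$) restricted to rows $0,\dots,m$. Its entry at $(\alpha,\beta)$ is $1$ if placing $\alpha$ in column $j$ and $\beta$ in column $j+1$ gives an independent set, and $0$ otherwise. The transfer matrix for gluing rows is defined in the same way with the roles of rows and columns exchanged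 (every edge joins vertices in the same row or consecutive rows). The lattice has transfer multiplicity one if, for each vector length, a single matrix (with a single index set) serves as the transfer matrix for all steps $j\to j+1$, in the column direction and likewise in the row direction. Cylinder and torus: $H_{n,m}$ is the graph obtained from $G_{m,n}$ by identifying its leftmost column with its rightmost column, $(i,0)\sim(i,n)$ for all $i$. $S_{n,m}$ is the graph obtained from $H_{n,m}$ by identifying its top row with its bottom row, $(0,j)\sim(m,j)$ for all $j$. Multiple edges are irrelevant, and a vertex carrying a loop belongs to no independent set. Thus $|V(G_{m,n})|=(m+1)(n+1)$, $|V(H_{n,m})|=(m+1)n$, $|V(S_{n,m})|=mn$. The limits $m,n\to\infty$ are double limits with $m$ and $n$ tending to infinity independently. *)

theory Defs
  imports Complex_Main
begin

section \<open>Graphs and independent sets\<close>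

text \<open>
  Multiple edges do not matter for independent sets, so a graph is a vertex set with an adjacency
  relation. Loops are allowed in the type because identifying vertices can create them;
  in \<^term>\<open>independent_set\<close> below the case \<^term>\<open>x = y\<close> excludes vertices carrying a loop.
\<close>

record 'a graph =
  verts :: "'a set"
  adj :: "'a \<Rightarrow> 'a \<Rightarrow> bool"

definition simple_graph :: "'a graph \<Rightarrow> bool" where
  "simple_graph G \<longleftrightarrow>
     (\<forall>x y. adj G x y \<longrightarrow> x \<in> verts G \<and> y \<in> verts G \<and> x \<noteq> y \<and> adj G y x)"

definition independent_set :: "'a graph \<Rightarrow> 'a set \<Rightarrow> bool" where
  "independent_set G S \<longleftrightarrow> S \<subseteq> verts G \<and> (\<forall>x\<in>S. \<forall>y\<in>S. \<not> adj G x y)"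

definition num_independent_sets :: "'a graph \<Rightarrow> nat" where
  "num_independent_sets G = card {S. independent_set G S}"

definition induced_subgraph :: "'a graph \<Rightarrow> 'a set \<Rightarrow> 'a graph" where
  "induced_subgraph G W =
     \<lparr>verts = verts G \<inter> W, adj = (\<lambda>x y. x \<in> W \<and> y \<in> W \<and> adj G x y)\<rparr>"

text \<open>
  The graph obtained from \<open>G\<close> by identifying \<open>x\<close> with \<open>y\<close> for all \<open>(x, y) \<in> r\<close>, where \<open>r\<close> relates
  vertices of \<open>G\<close>. Its vertices are the classes of the equivalence relation generated by \<open>r\<close>.
\<close>

definition identify :: "'a graph \<Rightarrow> ('a \<times> 'a) set \<Rightarrow> 'a set graph" where
  "identify G r =
     \<lparr>verts = verts G // (r \<union> r\<inverse>)\<^sup>*, adj = (\<lambda>X Y. \<exists>x\<in>X. \<exists>y\<in>Y. adj G x y)\<rparr>"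


section \<open>Lattices; plane, cylinder and torus graphs\<close>

text \<open>A vertex is a pair (row, column).\<close>

definition lattice_graph :: "(nat \<times> nat) graph \<Rightarrow> bool" where
  "lattice_graph L \<longleftrightarrow> simple_graph L \<and> verts L = UNIV"

definition plane_graph :: "(nat \<times> nat) graph \<Rightarrow> nat \<Rightarrow> nat \<Rightarrow> (nat \<times> nat) graph" where
  "plane_graph L m n = induced_subgraph L ({0..m} \<times> {0..n})"

text \<open>
  The arguments of the next two graphs are ordered as in the notation $H_{n,m}$ and $S_{n,m}$.
\<close>

definition cylinder_graph :: "(nat \<times> nat) graph \<Rightarrow> nat \<Rightarrow> nat \<Rightarrow> (nat \<times> nat) set graph" where
  "cylinder_graph L n m = identify (plane_graph L m n) {((i, 0), (i, n)) | i. i \<le> m}"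

definition torus_graph :: "(nat \<times> nat) graph \<Rightarrow> nat \<Rightarrow> nat \<Rightarrow> (nat \<times> nat) set set graph" where
  "torus_graph L n m =
     identify (cylinder_graph L n m)
       {(X, Y). X \<in> verts (cylinder_graph L n m) \<and> Y \<in> verts (cylinder_graph L n m) \<and>
                (\<exists>j\<le>n. (0, j) \<in> X \<and> (m, j) \<in> Y)}"


section \<open>Transfer matrices\<close>

text \<open>
  A real matrix with rows and columns indexed by arbitrary sets. Entries off the index sets
  carry no information and are set to 0 in all matrices below, so that equality of records is
  equality of matrices, index sets included.
\<close>

record 'i indexed_matrix =
  row_index :: "'i set"
  col_index :: "'i set"
  entry :: "'i \<Rightarrow> 'i \<Rightarrow> real"

definition symmetric_matrix :: "'i indexed_matrix \<Rightarrow> bool" where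
  "symmetric_matrix A \<longleftrightarrow>
     row_index A = col_index A \<and>
     (\<forall>\<alpha>\<in>row_index A. \<forall>\<beta>\<in>row_index A. entry A \<alpha> \<beta> = entry A \<beta> \<alpha>)"

text \<open>
  A line of the lattice (a row or a column) is given by the map \<open>p\<close> from positions on the
  line to vertices; the 0/1-vector \<open>\<alpha>\<close> on it stands for the vertex set \<open>line_set p \<alpha>\<close>.
\<close>

definition line_set :: "(nat \<Rightarrow> nat \<times> nat) \<Rightarrow> nat list \<Rightarrow> (nat \<times> nat) set" where
  "line_set p \<alpha> = {p k | k. k < length \<alpha> \<and> \<alpha> ! k = 1}"

definition line_vectors ::
    "(nat \<times> nat) graph \<Rightarrow> (nat \<Rightarrow> nat \<times> nat) \<Rightarrow> nat \<Rightarrow> nat list set" where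
  "line_vectors L p m =
     {\<alpha>. length \<alpha> = m + 1 \<and> set \<alpha> \<subseteq> {0, 1} \<and> independent_set L (line_set p \<alpha>)}"

definition gluing_matrix ::
    "(nat \<times> nat) graph \<Rightarrow> (nat \<Rightarrow> nat \<times> nat) \<Rightarrow> (nat \<Rightarrow> nat \<times> nat) \<Rightarrow> nat \<Rightarrow>
     nat list indexed_matrix" where
  "gluing_matrix L p q m =
     \<lparr>row_index = line_vectors L p m,
      col_index = line_vectors L q m,
      entry = (\<lambda>\<alpha> \<beta>. if \<alpha> \<in> line_vectors L p m \<and> \<beta> \<in> line_vectors L q m \<and>
                          independent_set L (line_set p \<alpha> \<union> line_set q \<beta>) then 1 else 0)\<rparr>"

text \<open>
  The transfer matrix of length \<open>m + 1\<close> for the step from column \<open>j\<close> to column \<open>j + 1\<close>,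
  and for the step from row \<open>i\<close> to row \<open>i + 1\<close>.
\<close>

definition column_transfer_matrix ::
    "(nat \<times> nat) graph \<Rightarrow> nat \<Rightarrow> nat \<Rightarrow> nat list indexed_matrix" where
  "column_transfer_matrix L m j = gluing_matrix L (\<lambda>i. (i, j)) (\<lambda>i. (i, j + 1)) m"

definition row_transfer_matrix ::
    "(nat \<times> nat) graph \<Rightarrow> nat \<Rightarrow> nat \<Rightarrow> nat list indexed_matrix" where
  "row_transfer_matrix L m i = gluing_matrix L (\<lambda>j. (i, j)) (\<lambda>j. (i + 1, j)) m"

definition edges_between_consecutive_columns :: "(nat \<times> nat) graph \<Rightarrow> bool" where
  "edges_between_consecutive_columns L \<longleftrightarrow>
     (\<forall>i j i' j'. adj L (i, j) (i', j') \<longrightarrow> j' = j \<or> j' = j + 1 \<or> j = j' + 1)"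

definition edges_between_consecutive_rows :: "(nat \<times> nat) graph \<Rightarrow> bool" where
  "edges_between_consecutive_rows L \<longleftrightarrow>
     (\<forall>i j i' j'. adj L (i, j) (i', j') \<longrightarrow> i' = i \<or> i' = i + 1 \<or> i = i' + 1)"

text \<open>
  The bound \<open>m \<ge> 1\<close> matches the range of the plane graphs. As the matrices carry their index sets,
  the index sets are also required to be the same for all steps.
\<close>

definition transfer_multiplicity_one :: "(nat \<times> nat) graph \<Rightarrow> bool" where
  "transfer_multiplicity_one L \<longleftrightarrow>
     edges_between_consecutive_columns L \<and> edges_between_consecutive_rows L \<and>
     (\<forall>m\<ge>1. (\<exists>T. \<forall>j. column_transfer_matrix L m j = T) \<and>
             (\<exists>T. \<forall>i. row_transfer_matrix L m i = T))"


section \<open>Entropy constants\<close>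

text \<open>
  \<open>\<eta>\<close> is the double limit, as \<open>m\<close> and \<open>n\<close> tend to infinity independently, of the number of
  independent sets of \<open>F m n\<close> to the power \<open>1 / |V(F m n)|\<close>.
\<close>

definition has_entropy_constant :: "(nat \<Rightarrow> nat \<Rightarrow> 'a graph) \<Rightarrow> real \<Rightarrow> bool" where
  "has_entropy_constant F \<eta> \<longleftrightarrow>
     ((\<lambda>(m, n). real (num_independent_sets (F m n)) powr (1 / real (card (verts (F m n)))))
        \<longlongrightarrow> \<eta>) (sequentially \<times>\<^sub>F sequentially)"

end

theory Submission
  imports Defs
begin

text \<open>
  Transfer multiplicity one makes \<open>L\<close> invariant under both unit translations. Hence the logarithm of
  the number of independent sets of an \<open>a \<times> b\<close> grid is subadditive in \<open>a\<close> and in \<open>b\<close>, and by a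
  two-dimensional Fekete argument its quotient by \<open>a b\<close> converges. Pulling independent sets back
  along the quotient map bounds the numbers for the cylinder and the torus from above by the
  number for the plane graph; leaving the border empty bounds all three from below by the number
  for the grid with the border removed, which is of negligible size.
\<close>

section \<open>Counting independent sets\<close>

lemma finite_independent_sets:
  assumes "finite (verts G)"
  shows "finite {S. independent_set G S}"
  by (rule finite_subset[of _ "Pow (verts G)"]) (use assms in \<open>auto simp: independent_set_def\<close>)

lemma num_independent_sets_ge_1:
  assumes "finite (verts G)"
  shows "num_independent_sets G \<ge> 1"
proof -
  have "{} \<in> {S. independent_set G S}"
    by (simp add: independent_set_def)
  then have "card {S. independent_set G S} > 0"
    using finite_independent_sets[OF assms] card_gt_0_iff by blast
  then show ?thesis
    by (simp add: num_independent_sets_def)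
qed

text \<open>Preimages of independent sets are independent because \<open>f\<close> sends edges to
  edges; an edge collapsed to one vertex becomes a loop there. Surjectivity recovers
  \<open>S\<close> as the image of its preimage.\<close>

lemma num_independent_sets_le_surj:
  assumes "finite (verts G)" and surj: "f ` verts G = verts G'"
    and hom: "\<And>x y. x \<in> verts G \<Longrightarrow> y \<in> verts G \<Longrightarrow> adj G x y \<Longrightarrow> adj G' (f x) (f y)"
  shows "num_independent_sets G' \<le> num_independent_sets G"
  unfolding num_independent_sets_def
proof (rule card_inj_on_le)
  let ?g = "\<lambda>S. {x \<in> verts G. f x \<in> S}"
  have "f ` ?g S = S" if "independent_set G' S" for S
  proof -
    have "S \<subseteq> f ` verts G"
      using that surj by (simp add: independent_set_def)
    then show ?thesis
      by blast
  qed
  then show "inj_on ?g {S. independent_set G' S}"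
    by (metis (mono_tags, lifting) inj_onI mem_Collect_eq)
  show "?g ` {S. independent_set G' S} \<subseteq> {S. independent_set G S}"
    using hom unfolding independent_set_def by blast
  show "finite {S. independent_set G S}"
    using assms(1) by (rule finite_independent_sets)
qed

text \<open>Since \<open>f\<close> reflects adjacency, images of independent sets are independent,
  and injectivity keeps distinct sets distinct.\<close>

lemma num_independent_sets_le_inj:
  assumes "finite (verts G')" and inj: "inj_on f (verts G)" and "f ` verts G \<subseteq> verts G'"
    and "\<And>x y. x \<in> verts G \<Longrightarrow> y \<in> verts G \<Longrightarrow> adj G' (f x) (f y) \<Longrightarrow> adj G x y"
  shows "num_independent_sets G \<le> num_independent_sets G'"
  unfolding num_independent_sets_def
proof (rule card_inj_on_le)
  show "inj_on ((`) f) {S. independent_set G S}"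
    by (rule inj_on_subset[OF inj_on_image_Pow[OF inj]]) (auto simp: independent_set_def)
  show "(`) f ` {S. independent_set G S} \<subseteq> {S. independent_set G' S}"
    using assms(3,4) unfolding independent_set_def by blast
  show "finite {S. independent_set G' S}"
    using assms(1) by (rule finite_independent_sets)
qed

text \<open>An independent set is determined by its traces on \<open>A\<close> and \<open>B\<close>;
  edges between the two parts only rule out some pairs of traces.\<close>

lemma num_independent_sets_induced_Un_le:
  assumes "finite A" "finite B"
  shows "num_independent_sets (induced_subgraph G (A \<union> B)) \<le>
    num_independent_sets (induced_subgraph G A) * num_independent_sets (induced_subgraph G B)"
  unfolding num_independent_sets_def card_cartesian_product[symmetric]
proof (rule card_inj_on_le)
  let ?g = "\<lambda>S. (S \<inter> A, S \<inter> B)"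
  let ?I = "\<lambda>A. {S. independent_set (induced_subgraph G A) S}"
  show "inj_on ?g (?I (A \<union> B))"
    by (rule inj_onI) (auto simp: independent_set_def induced_subgraph_def)
  show "?g ` ?I (A \<union> B) \<subseteq> ?I A \<times> ?I B"
    by (auto simp: independent_set_def induced_subgraph_def)
  show "finite (?I A \<times> ?I B)"
    using assms by (intro finite_cartesian_product finite_independent_sets)
      (auto simp: induced_subgraph_def)
qed


section \<open>Translation invariance\<close>

lemma lattice_adj_commute:
  assumes "lattice_graph L"
  shows "adj L x y \<longleftrightarrow> adj L y x"
  using assms unfolding lattice_graph_def simple_graph_def by blast

lemma lattice_not_adj_self:
  assumes "lattice_graph L"
  shows "\<not> adj L x x"
  using assms unfolding lattice_graph_def simple_graph_def by blast

lemma independent_set_pair: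
  assumes "lattice_graph L"
  shows "independent_set L {x, y} \<longleftrightarrow> \<not> adj L x y"
proof -
  have "independent_set L {x, y} \<longleftrightarrow> \<not> adj L x x \<and> \<not> adj L x y \<and> \<not> adj L y x \<and> \<not> adj L y y"
    using assms by (auto simp: independent_set_def lattice_graph_def)
  then show ?thesis
    using lattice_not_adj_self[OF assms] lattice_adj_commute[OF assms] by blast
qed

lemma independent_set_singleton:
  assumes "lattice_graph L"
  shows "independent_set L {x}"
  using independent_set_pair[OF assms, of x x] lattice_not_adj_self[OF assms] by simp

section \<open>Reading adjacency off the transfer matrices\<close>

definition indicator_vector :: "nat \<Rightarrow> nat set \<Rightarrow> nat list" where
  "indicator_vector m A = map (\<lambda>k. if k \<in> A then 1 else 0) [0..<m + 1]"

lemma line_set_indicator_vector: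
  assumes "A \<subseteq> {..m}"
  shows "line_set p (indicator_vector m A) = p ` A"
proof -
  have "(k < length (indicator_vector m A) \<and> indicator_vector m A ! k = 1) \<longleftrightarrow> k \<in> A" for k
  proof (cases "k \<le> m")
    case True
    then have "[0..<m + 1] ! k = k"
      by (metis add_0 less_Suc_eq_le Suc_eq_plus1 nth_upt)
    with True show ?thesis
      by (simp add: indicator_vector_def del: upt_Suc)
  next
    case False
    then show ?thesis
      using assms by (auto simp: indicator_vector_def)
  qed
  then show ?thesis
    unfolding line_set_def by auto
qed

lemma indicator_vector_in_line_vectors:
  assumes "A \<subseteq> {..m}"
  shows "indicator_vector m A \<in> line_vectors L p m \<longleftrightarrow> independent_set L (p ` A)"
  using line_set_indicator_vector[OF assms, of p]
  by (auto simp: line_vectors_def indicator_vector_def simp del: upt_Suc)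

text \<open>Edges inside a line show in the index set, which excludes the vector supported on
  \<open>{k, l}\<close>. Edges between the lines show in the entries: unit vectors are always
  indices, as there are no loops, and the entry at two of them vanishes exactly on an edge.\<close>

lemma gluing_matrix_eq_imp_adj_eq:
  assumes L: "lattice_graph L" and eq: "gluing_matrix L p q m = gluing_matrix L p' q' m"
    and k: "k \<le> m" and l: "l \<le> m"
  shows "adj L (p k) (p l) \<longleftrightarrow> adj L (p' k) (p' l)"
    and "adj L (p k) (q l) \<longleftrightarrow> adj L (p' k) (q' l)"
proof -
  have "line_vectors L p m = line_vectors L p' m"
    using arg_cong[OF eq, of row_index] by (simp add: gluing_matrix_def)
  then show "adj L (p k) (p l) \<longleftrightarrow> adj L (p' k) (p' l)"
    using indicator_vector_in_line_vectors[of "{k, l}" m L] k l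
    by (auto simp: independent_set_pair[OF L])
  have entry: "entry (gluing_matrix L p q m) (indicator_vector m {k}) (indicator_vector m {l}) =
      (if adj L (p k) (q l) then 0 else 1)" for p q :: "nat \<Rightarrow> nat \<times> nat"
    using k l
    by (simp add: gluing_matrix_def indicator_vector_in_line_vectors line_set_indicator_vector
        independent_set_singleton[OF L] independent_set_pair[OF L])
  show "adj L (p k) (q l) \<longleftrightarrow> adj L (p' k) (q' l)"
    using entry[of p q] entry[of p' q'] eq by (simp split: if_splits)
qed

section \<open>Invariance under unit translations\<close>

definition row_invariant :: "(nat \<times> nat) graph \<Rightarrow> bool" where
  "row_invariant L \<longleftrightarrow>
     (\<forall>i j i' j'. adj L (Suc i, j) (Suc i', j') \<longleftrightarrow> adj L (i, j) (i', j'))"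

definition column_invariant :: "(nat \<times> nat) graph \<Rightarrow> bool" where
  "column_invariant L \<longleftrightarrow>
     (\<forall>i j i' j'. adj L (i, Suc j) (i', Suc j') \<longleftrightarrow> adj L (i, j) (i', j'))"

text \<open>Every edge stays in a column or joins consecutive ones, so it is visible in the matrix
  of a single step, and the matrices of neighbouring steps agree.\<close>

lemma column_invariant_if_transfer_multiplicity_one:
  assumes L: "lattice_graph L" and T: "transfer_multiplicity_one L"
  shows "column_invariant L"
  unfolding column_invariant_def
proof (intro allI)
  fix i j i' j' :: nat
  \<comment> \<open>Any length covering both rows would do; \<open>Suc\<close> ensures
    \<open>m \<ge> 1\<close>, where the matrices are known to agree.\<close>
  define m where "m = Suc (max i i')"
  have m: "i \<le> m" "i' \<le> m" "m \<ge> 1"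
    by (auto simp: m_def)
  have eq: "gluing_matrix L (\<lambda>i. (i, Suc j)) (\<lambda>i. (i, Suc j + 1)) m =
      gluing_matrix L (\<lambda>i. (i, j)) (\<lambda>i. (i, j + 1)) m" for j
    using T m(3) unfolding transfer_multiplicity_one_def column_transfer_matrix_def by metis
  note adj_eq = gluing_matrix_eq_imp_adj_eq[OF L eq]
  consider "j' = j" | "j' = j + 1" | "j = j' + 1"
    | "\<not> (j' = j \<or> j' = j + 1 \<or> j = j' + 1)"
    by blast
  then show "adj L (i, Suc j) (i', Suc j') \<longleftrightarrow> adj L (i, j) (i', j')"
  proof cases
    case 1
    then show ?thesis using adj_eq(1)[OF m(1,2), of j] by simp
  next
    case 2
    then show ?thesis using adj_eq(2)[OF m(1,2), of j] by simp
  next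
    \<comment> \<open>The pair runs backwards, so the step from column \<open>j'\<close> is used
      with the endpoints exchanged.\<close>
    case 3
    then show ?thesis
      using adj_eq(2)[OF m(2,1), of j'] by (simp add: lattice_adj_commute[OF L, of "(i, _)"])
  next
    \<comment> \<open>The columns are at least two apart before and after the shift, so neither side
      is an edge.\<close>
    case 4
    have "edges_between_consecutive_columns L"
      using T by (simp add: transfer_multiplicity_one_def)
    with 4 show ?thesis
      unfolding edges_between_consecutive_columns_def by (metis Suc_eq_plus1 Suc_inject)
  qed
qed

text \<open>The argument for columns with the two coordinates exchanged.\<close>

lemma row_invariant_if_transfer_multiplicity_one:
  assumes L: "lattice_graph L" and T: "transfer_multiplicity_one L"
  shows "row_invariant L"
  unfolding row_invariant_def
proof (intro allI)
  fix i j i' j' :: nat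
  define m where "m = Suc (max j j')"
  have m: "j \<le> m" "j' \<le> m" "m \<ge> 1"
    by (auto simp: m_def)
  have eq: "gluing_matrix L (\<lambda>j. (Suc i, j)) (\<lambda>j. (Suc i + 1, j)) m =
      gluing_matrix L (\<lambda>j. (i, j)) (\<lambda>j. (i + 1, j)) m" for i
    using T m(3) unfolding transfer_multiplicity_one_def row_transfer_matrix_def by metis
  note adj_eq = gluing_matrix_eq_imp_adj_eq[OF L eq]
  consider "i' = i" | "i' = i + 1" | "i = i' + 1"
    | "\<not> (i' = i \<or> i' = i + 1 \<or> i = i' + 1)"
    by blast
  then show "adj L (Suc i, j) (Suc i', j') \<longleftrightarrow> adj L (i, j) (i', j')"
  proof cases
    case 1
    then show ?thesis using adj_eq(1)[OF m(1,2), of i] by simp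
  next
    case 2
    then show ?thesis using adj_eq(2)[OF m(1,2), of i] by simp
  next
    case 3
    then show ?thesis
      using adj_eq(2)[OF m(2,1), of i'] by (simp add: lattice_adj_commute[OF L, of "(_, j)"])
  next
    case 4
    have "edges_between_consecutive_rows L"
      using T by (simp add: transfer_multiplicity_one_def)
    with 4 show ?thesis
      unfolding edges_between_consecutive_rows_def by (metis Suc_eq_plus1 Suc_inject)
  qed
qed

lemma adj_translate:
  assumes "row_invariant L" "column_invariant L"
  shows "adj L (i + a, j + b) (i' + a, j' + b) \<longleftrightarrow> adj L (i, j) (i', j')"
proof -
  have "adj L (i + a, j) (i' + a, j') \<longleftrightarrow> adj L (i, j) (i', j')" for j j'
    using assms(1) by (induction a) (simp_all add: row_invariant_def)
  moreover have "adj L (i, j + b) (i', j' + b) \<longleftrightarrow> adj L (i, j) (i', j')" for i i'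
    using assms(2) by (induction b) (simp_all add: column_invariant_def)
  ultimately show ?thesis
    by simp
qed


section \<open>Grids\<close>

text \<open>Half-open ranges make \<open>a\<close> and \<open>b\<close> the numbers of rows and
  columns, so that sizes add when grids are joined and empty grids are allowed;
  \<open>plane_graph L m n\<close> has size \<open>m + 1\<close> by \<open>n + 1\<close>.\<close>

definition grid_count :: "(nat \<times> nat) graph \<Rightarrow> nat \<Rightarrow> nat \<Rightarrow> nat" where
  "grid_count L a b = num_independent_sets (induced_subgraph L ({0..<a} \<times> {0..<b}))"

lemma verts_induced_subgraph_lattice [simp]:
  "lattice_graph L \<Longrightarrow> verts (induced_subgraph L W) = W"
  by (simp add: induced_subgraph_def lattice_graph_def)

lemma adj_induced_subgraph [simp]:
  "adj (induced_subgraph L W) x y \<longleftrightarrow> x \<in> W \<and> y \<in> W \<and> adj L x y"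
  by (simp add: induced_subgraph_def)

text \<open>The shift by \<open>(c, d)\<close> preserves and reflects adjacency, so independent sets
  can be both pulled back and pushed forward along it.\<close>

lemma grid_count_translate:
  assumes L: "lattice_graph L" and inv: "row_invariant L" "column_invariant L"
  shows "num_independent_sets (induced_subgraph L ({c..<c + a} \<times> {d..<d + b})) = grid_count L a b"
proof -
  let ?f = "\<lambda>(i, j). (i + c, j + d)"
  have image: "?f ` ({0..<a} \<times> {0..<b}) = {c..<c + a} \<times> {d..<d + b}"
  proof (intro equalityI subsetI)
    fix x
    assume "x \<in> {c..<c + a} \<times> {d..<d + b}"
    then have "x = ?f (fst x - c, snd x - d)" "(fst x - c, snd x - d) \<in> {0..<a} \<times> {0..<b}"
      by auto
    then show "x \<in> ?f ` ({0..<a} \<times> {0..<b})"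
      by blast
  qed auto
  show ?thesis
    unfolding grid_count_def
  proof (rule antisym)
    show "num_independent_sets (induced_subgraph L ({c..<c + a} \<times> {d..<d + b}))
      \<le> num_independent_sets (induced_subgraph L ({0..<a} \<times> {0..<b}))"
      by (rule num_independent_sets_le_surj[where f = ?f])
        (use L image in \<open>auto simp: adj_translate[OF inv]\<close>)
    show "num_independent_sets (induced_subgraph L ({0..<a} \<times> {0..<b}))
      \<le> num_independent_sets (induced_subgraph L ({c..<c + a} \<times> {d..<d + b}))"
      by (rule num_independent_sets_le_inj[where f = ?f])
        (use L image in \<open>auto simp: adj_translate[OF inv] inj_on_def\<close>)
  qed
qed

lemma grid_count_add_row_le:
  assumes "lattice_graph L" "row_invariant L" "column_invariant L"
  shows "grid_count L (a + a') b \<le> grid_count L a b * grid_count L a' b"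
proof -
  \<comment> \<open>The form \<open>{0..<0 + b}\<close> presents the second block as a translate by
    \<open>(a, 0)\<close>, matching \<open>grid_count_translate\<close>.\<close>
  have "{0..<a + a'} \<times> {0..<b} = {0..<a} \<times> {0..<b} \<union> {a..<a + a'} \<times> {0..<0 + b}"
    by auto
  then show ?thesis
    using num_independent_sets_induced_Un_le[of "{0..<a} \<times> {0..<b}" "{a..<a + a'} \<times> {0..<0 + b}" L]
    unfolding grid_count_translate[OF assms] by (simp add: grid_count_def)
qed

lemma grid_count_add_column_le:
  assumes "lattice_graph L" "row_invariant L" "column_invariant L"
  shows "grid_count L a (b + b') \<le> grid_count L a b * grid_count L a b'"
proof -
  have "{0..<a} \<times> {0..<b + b'} = {0..<a} \<times> {0..<b} \<union> {0..<0 + a} \<times> {b..<b + b'}"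
    by auto
  then show ?thesis
    using num_independent_sets_induced_Un_le[of "{0..<a} \<times> {0..<b}" "{0..<0 + a} \<times> {b..<b + b'}" L]
    unfolding grid_count_translate[OF assms] by (simp add: grid_count_def)
qed

lemma grid_count_ge_1:
  assumes "lattice_graph L"
  shows "grid_count L a b \<ge> 1"
  unfolding grid_count_def using assms by (intro num_independent_sets_ge_1) simp


section \<open>A two-dimensional Fekete lemma\<close>

lemma subadditive_multiple_le:
  fixes f :: "nat \<Rightarrow> real"
  assumes "\<And>a b. f (a + b) \<le> f a + f b"
  shows "f (q * a + r) \<le> real q * f a + f r"
proof (induction q)
  case (Suc q)
  have "f (Suc q * a + r) \<le> f a + f (q * a + r)"
    using assms[of a "q * a + r"] by (simp add: add.assoc)
  with Suc show ?case
    by (simp add: algebra_simps)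
qed simp

text \<open>Division with remainder: the full blocks of length \<open>a\<close> give the main term,
  and fewer than \<open>a\<close> unit steps remain. The error does not depend on \<open>n\<close>,
  so it disappears after division by \<open>n\<close>.\<close>

lemma subadditive_linear_bound:
  fixes f :: "nat \<Rightarrow> real"
  assumes sub: "\<And>a b. f (a + b) \<le> f a + f b" and "f 0 = 0" and nonneg: "\<And>a. f a \<ge> 0" and "a \<ge> 1"
  shows "f n \<le> real n * f a / real a + real a * f 1"
proof -
  have "f (n div a * a + n mod a) \<le> real (n div a) * f a + f (n mod a)"
    by (rule subadditive_multiple_le[OF sub])
  also have "n div a * a + n mod a = n"
    by simp
  also have "real (n div a) \<le> real n / real a"
    by (rule of_nat_div_le_of_nat)
  \<comment> \<open>The remainder is cut into unit steps; \<open>f 0 = 0\<close> disposes of the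
    empty rest.\<close>
  also have "f (n mod a) \<le> real (n mod a) * f 1"
    using subadditive_multiple_le[OF sub, of "n mod a" 1 0] assms(2) by simp
  also have "real (n mod a) \<le> real a"
    using assms(4) by (simp add: less_imp_le)
  finally show ?thesis
    using nonneg by (simp add: mult_right_mono)
qed

lemma filterlim_fst_prod_filter: "filterlim fst F (F \<times>\<^sub>F G)"
  unfolding filterlim_def by (rule filtermap_fst_prod_filter)

lemma filterlim_snd_prod_filter: "filterlim snd G (F \<times>\<^sub>F G)"
  unfolding filterlim_def by (rule filtermap_snd_prod_filter)

text \<open>The limit is the infimum of the averages over all nonempty blocks. Tiling an
  \<open>m\<close> by \<open>n\<close> rectangle with a nearly optimal block leaves strips whose
  share is of order \<open>1 / m\<close> and \<open>1 / n\<close> separately, so no relation between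
  \<open>m\<close> and \<open>n\<close> is required.\<close>

lemma fekete_two_dimensional:
  fixes u :: "nat \<Rightarrow> nat \<Rightarrow> real"
  assumes row: "\<And>a a' b. u (a + a') b \<le> u a b + u a' b"
    and column: "\<And>a b b'. u a (b + b') \<le> u a b + u a b'"
    and nonneg: "\<And>a b. u a b \<ge> 0"
    and zero: "\<And>b. u 0 b = 0" "\<And>a. u a 0 = 0"
  shows "\<exists>l. ((\<lambda>(m, n). u m n / (real m * real n)) \<longlongrightarrow> l) (sequentially \<times>\<^sub>F sequentially)"
proof -
  define X where "X = {u a b / (real a * real b) | a b. a \<ge> 1 \<and> b \<ge> 1}"
  have X: "X \<noteq> {}" "bdd_below X"
    unfolding X_def by (auto intro!: bdd_belowI[of _ 0] simp: nonneg)
  \<comment> \<open>Cut first along the rows, then along the columns; the leftover strips are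
    estimated by unit cells of cost \<open>u 1 1\<close>.\<close>
  have bound: "u m n / (real m * real n) \<le>
      u a b / (real a * real b) + real b * u 1 1 / real n + real a * u 1 1 / real m"
    if "a \<ge> 1" "b \<ge> 1" "m \<ge> 1" "n \<ge> 1" for a b m n
  proof -
    have mn: "u m n \<le> real m * u a n / real a + real a * u 1 n"
      using subadditive_linear_bound[of "\<lambda>m. u m n" a m] row nonneg zero that(1) by blast
    have an: "u a n \<le> real n * u a b / real b + real b * u a 1"
      using subadditive_linear_bound[of "u a" b n] column nonneg zero that(2) by blast
    have "u 1 n \<le> real n * u 1 1"
      using subadditive_multiple_le[of "u 1" n 1 0] column zero by simp
    then have "real a * u 1 n \<le> real a * (real n * u 1 1)"
      by (intro mult_left_mono) auto
    with mn have "u m n / (real m * real n) \<le>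
        (real m * u a n / real a + real a * (real n * u 1 1)) / (real m * real n)"
      by (intro divide_right_mono) auto
    also have "\<dots> = u a n / (real a * real n) + real a * u 1 1 / real m"
      using that by (simp add: field_simps)
    finally have 1: "u m n / (real m * real n) \<le> u a n / (real a * real n) + real a * u 1 1 / real m" .
    have "u a 1 \<le> real a * u 1 1"
      using subadditive_multiple_le[of "\<lambda>m. u m 1" a 1 0] row zero by simp
    then have "real b * u a 1 \<le> real b * (real a * u 1 1)"
      by (intro mult_left_mono) auto
    with an have "u a n / (real a * real n) \<le>
        (real n * u a b / real b + real b * (real a * u 1 1)) / (real a * real n)"
      by (intro divide_right_mono) auto
    also have "\<dots> = u a b / (real a * real b) + real b * u 1 1 / real n"
      using that by (simp add: field_simps)
    finally show ?thesis
      using 1 by linarith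
  qed
  \<comment> \<open>At a zero argument the quotient has the default value 0, which need not belong
    to \<open>X\<close>.\<close>
  have pos: "eventually (\<lambda>x. fst x \<ge> 1 \<and> snd x \<ge> 1) (sequentially \<times>\<^sub>F sequentially)"
    unfolding eventually_prod_sequentially by (rule exI[of _ 1]) simp
  have "((\<lambda>x. u (fst x) (snd x) / (real (fst x) * real (snd x))) \<longlongrightarrow> Inf X)
      (sequentially \<times>\<^sub>F sequentially)"
  proof (rule order_tendstoI)
    fix c
    assume c: "c < Inf X"
    show "eventually (\<lambda>x. c < u (fst x) (snd x) / (real (fst x) * real (snd x)))
        (sequentially \<times>\<^sub>F sequentially)"
      using pos
    proof eventually_elim
      case (elim x)
      then have "u (fst x) (snd x) / (real (fst x) * real (snd x)) \<in> X"
        unfolding X_def by blast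
      then show ?case
        using cInf_lower[OF _ X(2)] c by (meson less_le_trans)
    qed
  next
    fix c
    assume "Inf X < c"
    \<comment> \<open>This fixed block beats \<open>c\<close>; only the two vanishing error terms of
      \<open>bound\<close> must still fit in the gap.\<close>
    then obtain a b where ab: "a \<ge> 1" "b \<ge> 1" "u a b / (real a * real b) < c"
      using cInf_less_iff[OF X] unfolding X_def by blast
    let ?g = "\<lambda>x. u a b / (real a * real b) + real b * u 1 1 / real (snd x)
      + real a * u 1 1 / real (fst x)"
    have "(?g \<longlongrightarrow> u a b / (real a * real b) + 0 + 0) (sequentially \<times>\<^sub>F sequentially)"
      by (intro tendsto_add tendsto_const filterlim_compose[OF lim_const_over_n filterlim_snd_prod_filter]
          filterlim_compose[OF lim_const_over_n filterlim_fst_prod_filter])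
    then have "eventually (\<lambda>x. ?g x < c) (sequentially \<times>\<^sub>F sequentially)"
      using ab(3) by (intro order_tendstoD) auto
    with pos show "eventually (\<lambda>x. u (fst x) (snd x) / (real (fst x) * real (snd x)) < c)
        (sequentially \<times>\<^sub>F sequentially)"
    proof eventually_elim
      case (elim x)
      then show ?case
        using bound[OF ab(1,2), of "fst x" "snd x"] by linarith
    qed
  qed
  then show ?thesis
    unfolding case_prod_beta by blast
qed


section \<open>Comparison with grids\<close>

text \<open>A squeeze for logarithms: the two bounding grids differ by a border whose share of the
  area tends to 0, so both have the same limit \<open>l\<close> per vertex.\<close>

lemma has_entropy_constant_if_between_grids:
  fixes L :: "(nat \<times> nat) graph"
  assumes L: "lattice_graph L"
    and lim: "((\<lambda>(a, b). ln (real (grid_count L a b)) / (real a * real b)) \<longlongrightarrow> l)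
      (sequentially \<times>\<^sub>F sequentially)"
    and count: "\<And>m n. grid_count L (m - 1) (n - 1) \<le> num_independent_sets (F m n)"
      "\<And>m n. num_independent_sets (F m n) \<le> grid_count L (m + 1) (n + 1)"
    and card: "\<And>m n. (m - 1) * (n - 1) \<le> card (verts (F m n))"
      "\<And>m n. card (verts (F m n)) \<le> (m + 1) * (n + 1)"
  shows "has_entropy_constant F (exp l)"
proof -
  let ?u = "\<lambda>a b. ln (real (grid_count L a b))"
  let ?S = "sequentially \<times>\<^sub>F sequentially :: (nat \<times> nat) filter"
  let ?i = "\<lambda>x. real (num_independent_sets (F (fst x) (snd x)))"
  let ?v = "\<lambda>x. real (card (verts (F (fst x) (snd x))))"
  \<comment> \<open>After cancellation, \<open>?lo\<close> is the logarithm for the small grid over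
    the large area, and \<open>?hi\<close> the reverse; written as products, they show the known
    limit times ratios tending to 1.\<close>
  let ?lo = "\<lambda>m n. ?u (m - 1) (n - 1) / (real (m - 1) * real (n - 1)) *
    (real (m - 1) / real (m + 1)) * (real (n - 1) / real (n + 1))"
  let ?hi = "\<lambda>m n. ?u (m + 1) (n + 1) / (real (m + 1) * real (n + 1)) *
    (real (m + 1) / real (m - 1)) * (real (n + 1) / real (n - 1))"
  have shift: "filterlim (\<lambda>x. (fst x - 1, snd x - 1)) ?S ?S"
    "filterlim (\<lambda>x. (fst x + 1, snd x + 1)) ?S ?S"
    by (intro filterlim_Pair filterlim_compose[OF filterlim_minus_const_nat_at_top filterlim_fst_prod_filter]
        filterlim_compose[OF filterlim_minus_const_nat_at_top filterlim_snd_prod_filter]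
        filterlim_compose[OF filterlim_add_const_nat_at_top filterlim_fst_prod_filter]
        filterlim_compose[OF filterlim_add_const_nat_at_top filterlim_snd_prod_filter])+
  have ratio: "(\<lambda>n. real (n - 1) / real (n + 1)) \<longlonglongrightarrow> 1" "(\<lambda>n. real (n + 1) / real (n - 1)) \<longlonglongrightarrow> 1"
  proof -
    \<comment> \<open>This is \<open>(n - 1) / (n + 1)\<close> rewritten; with truncated subtraction
      the identity fails at \<open>n = 0\<close>, hence the eventual equality.\<close>
    have "(\<lambda>n. 1 - 2 * inverse (real (Suc n))) \<longlonglongrightarrow> 1 - 2 * 0"
      by (intro tendsto_diff tendsto_mult tendsto_const LIMSEQ_inverse_real_of_nat)
    moreover have "eventually (\<lambda>n. 1 - 2 * inverse (real (Suc n)) = real (n - 1) / real (n + 1))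
        sequentially"
      using eventually_ge_at_top[of 1] by eventually_elim (simp add: field_simps of_nat_diff)
    ultimately show lim: "(\<lambda>n. real (n - 1) / real (n + 1)) \<longlonglongrightarrow> 1"
      by (simp add: Lim_transform_eventually)
    show "(\<lambda>n. real (n + 1) / real (n - 1)) \<longlonglongrightarrow> 1"
      using tendsto_inverse[OF lim] by (simp add: inverse_divide)
  qed
  have lo_lim: "((\<lambda>x. ?lo (fst x) (snd x)) \<longlongrightarrow> l * 1 * 1) ?S"
    using filterlim_compose[OF lim shift(1)] unfolding case_prod_beta fst_conv snd_conv
    by (intro tendsto_mult filterlim_compose[OF ratio(1) filterlim_fst_prod_filter]
        filterlim_compose[OF ratio(1) filterlim_snd_prod_filter])
  have hi_lim: "((\<lambda>x. ?hi (fst x) (snd x)) \<longlongrightarrow> l * 1 * 1) ?S"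
    using filterlim_compose[OF lim shift(2)] unfolding case_prod_beta fst_conv snd_conv
    by (intro tendsto_mult filterlim_compose[OF ratio(2) filterlim_fst_prod_filter]
        filterlim_compose[OF ratio(2) filterlim_snd_prod_filter])
  \<comment> \<open>From 2 on, the small grid is nonempty, so the vertex count is positive and the
    factors of \<open>?lo\<close> and \<open>?hi\<close> cancel.\<close>
  have "eventually (\<lambda>x. fst x \<ge> 2 \<and> snd x \<ge> 2) ?S"
    unfolding eventually_prod_sequentially by (rule exI[of _ 2]) simp
  then have bounds: "eventually (\<lambda>x. ?lo (fst x) (snd x) \<le> ln (?i x) / ?v x \<and>
      ln (?i x) / ?v x \<le> ?hi (fst x) (snd x)) ?S"
  proof eventually_elim
    case (elim x)
    obtain m n where x: "x = (m, n)"
      by force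
    with elim have mn: "m \<ge> 2" "n \<ge> 2"
      by auto
    have pos: "grid_count L a b \<ge> 1" for a b
      by (rule grid_count_ge_1[OF L])
    have i: "1 \<le> num_independent_sets (F m n)"
      using pos count(1) by (rule order_trans)
    have u: "?u (m - 1) (n - 1) \<le> ln (?i x)" "ln (?i x) \<le> ?u (m + 1) (n + 1)" "0 \<le> ln (?i x)"
      using pos[of "m - 1" "n - 1"] pos[of "m + 1" "n + 1"] count[of m n] i
      unfolding x by simp_all
    have "real ((m - 1) * (n - 1)) \<le> ?v x" "?v x \<le> real ((m + 1) * (n + 1))"
      unfolding x fst_conv snd_conv of_nat_le_iff by (rule card)+
    then have v: "real (m - 1) * real (n - 1) \<le> ?v x" "?v x \<le> real (m + 1) * real (n + 1)"
      unfolding of_nat_mult .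
    have pos': "0 < real (m - 1) * real (n - 1)"
      using mn by simp
    note v_pos = less_le_trans[OF pos' v(1)]
    have "?lo m n = ?u (m - 1) (n - 1) / (real (m + 1) * real (n + 1))"
      using mn by simp
    also have "\<dots> \<le> ln (?i x) / ?v x"
      using u v v_pos by (intro frac_le) linarith+
    finally have lo: "?lo m n \<le> ln (?i x) / ?v x" .
    have "ln (?i x) / ?v x \<le> ?u (m + 1) (n + 1) / (real (m - 1) * real (n - 1))"
      using u v pos' by (intro frac_le) linarith+
    also have "\<dots> = ?hi m n"
      using mn by simp
    finally show ?case
      using lo x by simp
  qed
  have "((\<lambda>x. ln (?i x) / ?v x) \<longlongrightarrow> l * 1 * 1) ?S"
    by (rule tendsto_sandwich[OF _ _ lo_lim hi_lim]; rule eventually_mono[OF bounds]) blast+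
  then have "((\<lambda>x. ln (?i x) / ?v x) \<longlongrightarrow> l) ?S"
    by simp
  then have "((\<lambda>x. exp (ln (?i x) / ?v x)) \<longlongrightarrow> exp l) ?S"
    by (rule tendsto_exp)
  \<comment> \<open>\<open>powr\<close> is 0 at base 0, so the exponential form relies on the count
    being positive.\<close>
  moreover have "?i x powr (1 / ?v x) = exp (ln (?i x) / ?v x)" for x
    using order_trans[OF grid_count_ge_1[OF L] count(1), of "fst x" "snd x"]
    by (simp add: powr_def)
  ultimately show ?thesis
    unfolding has_entropy_constant_def case_prod_beta by simp
qed

text \<open>Here \<open>f\<close> is to be a quotient map. It preserves edges everywhere, which
  gives the upper bound; off the border it is injective and reflects edges, which gives the lower
  bound.\<close>

lemma between_grids:
  assumes L: "lattice_graph L" and inv: "row_invariant L" "column_invariant L"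
    and surj: "f ` ({0..m} \<times> {0..n}) = verts G"
    and hom: "\<And>x y. x \<in> {0..m} \<times> {0..n} \<Longrightarrow> y \<in> {0..m} \<times> {0..n} \<Longrightarrow> adj L x y \<Longrightarrow>
      adj G (f x) (f y)"
    and inj: "inj_on f ({1..<m} \<times> {1..<n})"
    and hom': "\<And>x y. x \<in> {1..<m} \<times> {1..<n} \<Longrightarrow> y \<in> {1..<m} \<times> {1..<n} \<Longrightarrow>
      adj G (f x) (f y) \<Longrightarrow> adj L x y"
  shows "grid_count L (m - 1) (n - 1) \<le> num_independent_sets G"
    and "num_independent_sets G \<le> grid_count L (m + 1) (n + 1)"
    and "(m - 1) * (n - 1) \<le> card (verts G)"
    and "card (verts G) \<le> (m + 1) * (n + 1)"
proof -
  let ?full = "{0..m} \<times> {0..n}" and ?inner = "{1..<m} \<times> {1..<n}"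
  have full: "{0..<m + 1} \<times> {0..<n + 1} = ?full"
    by auto
  \<comment> \<open>The inner grid is the translate of the small grid by \<open>(1, 1)\<close>;
    truncation is harmless, since both sides are empty when \<open>m\<close> or \<open>n\<close> is
    0.\<close>
  have inner: "{1..<1 + (m - 1)} \<times> {1..<1 + (n - 1)} = ?inner"
    by auto
  have fin: "finite (verts G)"
    unfolding surj[symmetric] by simp
  have sub: "f ` ?inner \<subseteq> verts G"
    unfolding surj[symmetric] by (intro image_mono) auto
  show "grid_count L (m - 1) (n - 1) \<le> num_independent_sets G"
    unfolding grid_count_translate[OF L inv, of 1 _ 1, symmetric] inner
    by (rule num_independent_sets_le_inj[where f = f]) (use L fin inj sub hom' in auto)
  show "num_independent_sets G \<le> grid_count L (m + 1) (n + 1)"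
    unfolding grid_count_def full
    by (rule num_independent_sets_le_surj[where f = f]) (use L surj hom in auto)
  show "(m - 1) * (n - 1) \<le> card (verts G)"
    using card_inj_on_le[OF inj sub fin] by simp
  show "card (verts G) \<le> (m + 1) * (n + 1)"
    using card_image_le[of ?full f] surj by simp
qed


section \<open>Quotient graphs\<close>

text \<open>The quotient map onto the vertices of \<open>identify G r\<close>.\<close>

definition identify_class :: "('a \<times> 'a) set \<Rightarrow> 'a \<Rightarrow> 'a set" where
  "identify_class r x = (r \<union> r\<inverse>)\<^sup>* `` {x}"

lemma verts_identify: "verts (identify G r) = identify_class r ` verts G"
  by (auto simp: identify_def quotient_def identify_class_def)

lemma adj_identify: "adj (identify G r) X Y \<longleftrightarrow> (\<exists>x\<in>X. \<exists>y\<in>Y. adj G x y)"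
  by (simp add: identify_def)

lemma mem_identify_class: "x \<in> identify_class r x"
  by (simp add: identify_class_def)

lemma adj_identify_class:
  "adj G x y \<Longrightarrow> adj (identify G r) (identify_class r x) (identify_class r y)"
  using mem_identify_class[of x r] mem_identify_class[of y r] by (auto simp: adj_identify)

text \<open>A path in the generated equivalence that leaves \<open>x\<close> would need a first
  step, but no pair of \<open>r\<close> contains \<open>x\<close>.\<close>

lemma identify_class_eq_singleton:
  assumes "x \<notin> Field r"
  shows "identify_class r x = {x}"
proof -
  have "y = x" if "(x, y) \<in> (r \<union> r\<inverse>)\<^sup>*" for y
    using that by (cases rule: converse_rtranclE) (use assms in \<open>auto simp: Field_def\<close>)
  then show ?thesis
    by (auto simp: identify_class_def)
qed

section \<open>The gluings that produce cylinder and torus\<close>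

definition column_gluing :: "nat \<Rightarrow> nat \<Rightarrow> ((nat \<times> nat) \<times> (nat \<times> nat)) set" where
  "column_gluing m n = {((i, 0), (i, n)) | i. i \<le> m}"

definition row_gluing ::
    "(nat \<times> nat) graph \<Rightarrow> nat \<Rightarrow> nat \<Rightarrow> ((nat \<times> nat) set \<times> (nat \<times> nat) set) set" where
  "row_gluing L m n =
     {(X, Y). X \<in> verts (cylinder_graph L n m) \<and> Y \<in> verts (cylinder_graph L n m) \<and>
              (\<exists>j\<le>n. (0, j) \<in> X \<and> (m, j) \<in> Y)}"

lemma column_class_inner:
  assumes "x \<in> {1..<m} \<times> {1..<n}"
  shows "identify_class (column_gluing m n) x = {x}"
  using assms by (intro identify_class_eq_singleton) (auto simp: Field_def column_gluing_def)

text \<open>The second gluing acts on classes of the first; it only relates classes meeting row 0 or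
  row \<open>m\<close>, which \<open>{x}\<close> avoids.\<close>

lemma row_class_inner:
  assumes "x \<in> {1..<m} \<times> {1..<n}"
  shows "identify_class (row_gluing L m n) {x} = {{x}}"
  using assms by (intro identify_class_eq_singleton) (auto simp: Field_def row_gluing_def)

lemma verts_plane_graph: "lattice_graph L \<Longrightarrow> verts (plane_graph L m n) = {0..m} \<times> {0..n}"
  by (simp add: plane_graph_def)

lemma adj_plane_graph:
  "adj (plane_graph L m n) x y \<longleftrightarrow> x \<in> {0..m} \<times> {0..n} \<and> y \<in> {0..m} \<times> {0..n} \<and> adj L x y"
  by (simp add: plane_graph_def)

lemma cylinder_graph_eq: "cylinder_graph L n m = identify (plane_graph L m n) (column_gluing m n)"
  by (simp add: cylinder_graph_def column_gluing_def)

lemma torus_graph_eq: "torus_graph L n m = identify (cylinder_graph L n m) (row_gluing L m n)"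
  by (simp add: torus_graph_def row_gluing_def)

section \<open>Plane, cylinder and torus between two grids\<close>

lemma plane_between_grids:
  assumes "lattice_graph L" "row_invariant L" "column_invariant L"
  shows "grid_count L (m - 1) (n - 1) \<le> num_independent_sets (plane_graph L m n)"
    and "num_independent_sets (plane_graph L m n) \<le> grid_count L (m + 1) (n + 1)"
    and "(m - 1) * (n - 1) \<le> card (verts (plane_graph L m n))"
    and "card (verts (plane_graph L m n)) \<le> (m + 1) * (n + 1)"
  by (rule between_grids[OF assms, where f = "\<lambda>x. x"];
      use assms in \<open>auto simp: verts_plane_graph adj_plane_graph\<close>)+

lemma cylinder_between_grids:
  assumes "lattice_graph L" "row_invariant L" "column_invariant L"
  shows "grid_count L (m - 1) (n - 1) \<le> num_independent_sets (cylinder_graph L n m)"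
    and "num_independent_sets (cylinder_graph L n m) \<le> grid_count L (m + 1) (n + 1)"
    and "(m - 1) * (n - 1) \<le> card (verts (cylinder_graph L n m))"
    and "card (verts (cylinder_graph L n m)) \<le> (m + 1) * (n + 1)"
proof -
  let ?f = "identify_class (column_gluing m n)"
  have surj: "?f ` ({0..m} \<times> {0..n}) = verts (cylinder_graph L n m)"
    by (simp add: cylinder_graph_eq verts_identify verts_plane_graph[OF assms(1)])
  have hom: "adj (cylinder_graph L n m) (?f x) (?f y)"
    if "x \<in> {0..m} \<times> {0..n}" "y \<in> {0..m} \<times> {0..n}" "adj L x y" for x y
    unfolding cylinder_graph_eq by (intro adj_identify_class) (simp add: adj_plane_graph that)
  have inj: "inj_on ?f ({1..<m} \<times> {1..<n})"
    by (rule inj_onI) (simp add: column_class_inner)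
  \<comment> \<open>Classes are adjacent when some representatives are; inner classes are
    singletons, so the representatives are \<open>x\<close> and \<open>y\<close> themselves.\<close>
  have hom': "adj L x y" if "x \<in> {1..<m} \<times> {1..<n}" "y \<in> {1..<m} \<times> {1..<n}"
    "adj (cylinder_graph L n m) (?f x) (?f y)" for x y
    using that(3) unfolding column_class_inner[OF that(1)] column_class_inner[OF that(2)]
    by (simp add: cylinder_graph_eq adj_identify adj_plane_graph)
  show "grid_count L (m - 1) (n - 1) \<le> num_independent_sets (cylinder_graph L n m)"
    and "num_independent_sets (cylinder_graph L n m) \<le> grid_count L (m + 1) (n + 1)"
    and "(m - 1) * (n - 1) \<le> card (verts (cylinder_graph L n m))"
    and "card (verts (cylinder_graph L n m)) \<le> (m + 1) * (n + 1)"
    by (rule between_grids[OF assms surj _ inj]; erule (2) hom hom')+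
qed

text \<open>The quotient map is now the composition of the two gluings, hence the nested singletons
  on the inner grid.\<close>

lemma torus_between_grids:
  assumes "lattice_graph L" "row_invariant L" "column_invariant L"
  shows "grid_count L (m - 1) (n - 1) \<le> num_independent_sets (torus_graph L n m)"
    and "num_independent_sets (torus_graph L n m) \<le> grid_count L (m + 1) (n + 1)"
    and "(m - 1) * (n - 1) \<le> card (verts (torus_graph L n m))"
    and "card (verts (torus_graph L n m)) \<le> (m + 1) * (n + 1)"
proof -
  let ?f = "\<lambda>x. identify_class (row_gluing L m n) (identify_class (column_gluing m n) x)"
  have surj: "?f ` ({0..m} \<times> {0..n}) = verts (torus_graph L n m)"
    by (simp add: torus_graph_eq cylinder_graph_eq verts_identify verts_plane_graph[OF assms(1)]
        image_image)
  have hom: "adj (torus_graph L n m) (?f x) (?f y)"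
    if "x \<in> {0..m} \<times> {0..n}" "y \<in> {0..m} \<times> {0..n}" "adj L x y" for x y
    unfolding torus_graph_eq cylinder_graph_eq
    by (intro adj_identify_class) (simp add: adj_plane_graph that)
  have inner: "?f x = {{x}}" if "x \<in> {1..<m} \<times> {1..<n}" for x
    using that by (simp only: column_class_inner row_class_inner)
  have inj: "inj_on ?f ({1..<m} \<times> {1..<n})"
    by (rule inj_onI) (simp add: inner)
  have hom': "adj L x y" if "x \<in> {1..<m} \<times> {1..<n}" "y \<in> {1..<m} \<times> {1..<n}"
    "adj (torus_graph L n m) (?f x) (?f y)" for x y
    using that(3) unfolding inner[OF that(1)] inner[OF that(2)]
    by (simp add: torus_graph_eq cylinder_graph_eq adj_identify adj_plane_graph)
  show "grid_count L (m - 1) (n - 1) \<le> num_independent_sets (torus_graph L n m)"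
    and "num_independent_sets (torus_graph L n m) \<le> grid_count L (m + 1) (n + 1)"
    and "(m - 1) * (n - 1) \<le> card (verts (torus_graph L n m))"
    and "card (verts (torus_graph L n m)) \<le> (m + 1) * (n + 1)"
    by (rule between_grids[OF assms surj _ inj]; erule (2) hom hom')+
qed

theorem theorem2p2:
  fixes L :: "(nat \<times> nat) graph"
  assumes "lattice_graph L"
    and "transfer_multiplicity_one L"
    and "\<forall>m\<ge>1. \<forall>j i. column_transfer_matrix L m j = row_transfer_matrix L m i"
    and "\<forall>m\<ge>1. \<forall>j. symmetric_matrix (column_transfer_matrix L m j)"
  shows "\<exists>\<eta>. has_entropy_constant (\<lambda>m n. plane_graph L m n) \<eta> \<and>
             has_entropy_constant (\<lambda>m n. cylinder_graph L n m) \<eta> \<and>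
             has_entropy_constant (\<lambda>m n. torus_graph L n m) \<eta>"
proof -
  note L = assms(1)
  note inv = row_invariant_if_transfer_multiplicity_one[OF assms(1,2)]
    column_invariant_if_transfer_multiplicity_one[OF assms(1,2)]
  have pos: "real (grid_count L a b) \<ge> 1" for a b
    using grid_count_ge_1[OF L] by simp
  \<comment> \<open>Logarithms turn submultiplicativity of \<open>grid_count\<close> into the
    subadditivity that Fekete's argument uses.\<close>
  have ln_le: "ln (real k) \<le> ln (real (grid_count L a b)) + ln (real (grid_count L c d))"
    if "k \<ge> 1" "k \<le> grid_count L a b * grid_count L c d" for k a b c d
  proof -
    have "ln (real k) \<le> ln (real (grid_count L a b) * real (grid_count L c d))"
      using that unfolding of_nat_mult[symmetric]
      by (intro ln_mono) (simp_all only: of_nat_le_iff of_nat_0_less_iff)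
    also have "\<dots> = ln (real (grid_count L a b)) + ln (real (grid_count L c d))"
      using pos[of a b] pos[of c d] by (intro ln_mult_pos) auto
    finally show ?thesis .
  qed
  \<comment> \<open>An empty grid has only the empty independent set, so its logarithm is 0, as
    required on the axes.\<close>
  have empty: "num_independent_sets (induced_subgraph L {}) = 1"
    by (simp add: num_independent_sets_def independent_set_def induced_subgraph_def cong: conj_cong)
  have "\<exists>l. ((\<lambda>(a, b). ln (real (grid_count L a b)) / (real a * real b)) \<longlongrightarrow> l)
      (sequentially \<times>\<^sub>F sequentially)"
  proof (rule fekete_two_dimensional)
    show "ln (real (grid_count L (a + a') b)) \<le>
        ln (real (grid_count L a b)) + ln (real (grid_count L a' b))" for a a' b
      by (intro ln_le grid_count_ge_1[OF L] grid_count_add_row_le[OF L inv])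
    show "ln (real (grid_count L a (b + b'))) \<le>
        ln (real (grid_count L a b)) + ln (real (grid_count L a b'))" for a b b'
      by (intro ln_le grid_count_ge_1[OF L] grid_count_add_column_le[OF L inv])
    show "ln (real (grid_count L a b)) \<ge> 0" for a b
      by (rule ln_ge_zero[OF pos])
    show "ln (real (grid_count L 0 b)) = 0" "ln (real (grid_count L a 0)) = 0" for a b
      by (simp_all add: grid_count_def empty)
  qed
  then obtain l where lim: "((\<lambda>(a, b). ln (real (grid_count L a b)) / (real a * real b)) \<longlongrightarrow> l)
      (sequentially \<times>\<^sub>F sequentially)" ..
  \<comment> \<open>The limit \<open>l\<close> depends only on the grids, so \<open>exp l\<close>
    serves all three families.\<close>
  note entropy = has_entropy_constant_if_between_grids[OF L lim]
  show ?thesis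
    by (intro exI[of _ "exp l"] conjI entropy plane_between_grids[OF L inv]
        cylinder_between_grids[OF L inv] torus_between_grids[OF L inv])
qed

end
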